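(* Let $N=\{1,\dots,n\}$ be a finite player set and let $v\colon 2^N\to\mathbb R$ be a standard cooperative game on $N$. If $v$ is $\alpha$-top dominant for some $\alpha>0$, then $v$ is regular as well as partitionally superadditive.
   Context: A cooperative game on $N$ is a function $v\colon 2^N\to\mathbb R$ with $v(\varnothing)=0$. Write $v_i=v(\{i\})$ and $M_i(v)=v(N)-v(N\setminus\{i\})$ for $i\in N$. The game $v$ is standard if $v_i\leqslant M_i(v)$ for every $i\in N$ and $v_j<M_j(v)$ for at least one $j\in N$. It is essential if $\sum_{j\in N}v_j\leqslant v(N)\leqslant\sum_{j\in N}M_j(v)$. It is regular if it is both essential and standard. It is partitionally superadditive if $v(S)+v(N\setminus S)\leqslant v(N)$ for every $S\subseteq N$. For $\alpha>0$, $v$ is $\alpha$-top dominant if for every coalition $S\subseteq N$ $$\Big[v(S)-\sum_{j\in S}v_j\Big]\cdot\sum_{j\in N}(M_j(v)-v_j)^\alpha\ \leqslant\ \Big[v(N)-\sum_{j\in N}v_j\Big]\cdot\sum_{j\in S}(M_j(v)-v_j)^\alpha .$$ *)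

theory Defs
  imports Complex_Main
begin

text \<open>
  A game on the player set \<open>N\<close> is a function \<open>v\<close> on sets of players; only its values on
  subsets of \<open>N\<close> are relevant.
\<close>

definition cooperative_game :: "'a set \<Rightarrow> ('a set \<Rightarrow> real) \<Rightarrow> bool" where
  "cooperative_game N v \<longleftrightarrow> finite N \<and> v {} = 0"

definition individual_worth :: "('a set \<Rightarrow> real) \<Rightarrow> 'a \<Rightarrow> real" where
  "individual_worth v i = v {i}"

definition marginal :: "'a set \<Rightarrow> ('a set \<Rightarrow> real) \<Rightarrow> 'a \<Rightarrow> real" where
  "marginal N v i = v N - v (N - {i})"

definition standard :: "'a set \<Rightarrow> ('a set \<Rightarrow> real) \<Rightarrow> bool" where
  "standard N v \<longleftrightarrow>
     (\<forall>i\<in>N. individual_worth v i \<le> marginal N v i) \<and>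
     (\<exists>j\<in>N. individual_worth v j < marginal N v j)"

definition essential :: "'a set \<Rightarrow> ('a set \<Rightarrow> real) \<Rightarrow> bool" where
  "essential N v \<longleftrightarrow>
     (\<Sum>j\<in>N. individual_worth v j) \<le> v N \<and> v N \<le> (\<Sum>j\<in>N. marginal N v j)"

definition regular :: "'a set \<Rightarrow> ('a set \<Rightarrow> real) \<Rightarrow> bool" where
  "regular N v \<longleftrightarrow> essential N v \<and> standard N v"

definition partitionally_superadditive :: "'a set \<Rightarrow> ('a set \<Rightarrow> real) \<Rightarrow> bool" where
  "partitionally_superadditive N v \<longleftrightarrow> (\<forall>S\<subseteq>N. v S + v (N - S) \<le> v N)"

text \<open>
  The power \<open>(M\<^sub>j(v) - v\<^sub>j)\<^sup>\<alpha>\<close> with a real exponent is only meaningful for a nonnegative base,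
  that is, for standard games. For \<open>\<alpha> > 0\<close>, \<open>powr\<close> agrees there with the usual power, including
  \<open>0 powr \<alpha> = 0\<close>.
\<close>

definition top_dominant :: "real \<Rightarrow> 'a set \<Rightarrow> ('a set \<Rightarrow> real) \<Rightarrow> bool" where
  "top_dominant \<alpha> N v \<longleftrightarrow>
     (\<forall>S\<subseteq>N.
        (v S - (\<Sum>j\<in>S. individual_worth v j)) *
          (\<Sum>j\<in>N. (marginal N v j - individual_worth v j) powr \<alpha>)
        \<le> (v N - (\<Sum>j\<in>N. individual_worth v j)) *
          (\<Sum>j\<in>S. (marginal N v j - individual_worth v j) powr \<alpha>))"

end

theory Submission
  imports Defs
begin

text \<open>
  Write \<open>d\<^sub>j = M\<^sub>j(v) - v\<^sub>j\<close>, \<open>P(S) = (\<Sum>j\<in>S. d\<^sub>j\<^sup>\<alpha>)\<close> and \<open>w(S) = v(S) - (\<Sum>j\<in>S. v\<^sub>j)\<close>, so that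
  top dominance reads \<open>w(S) P(N) \<le> w(N) P(S)\<close>, where \<open>P(N) > 0\<close> by standardness. Adding
  the inequalities for \<open>S\<close> and \<open>N - S\<close> gives partitional superadditivity; \<open>S = {j}\<close> with
  \<open>d\<^sub>j > 0\<close> gives \<open>w(N) \<ge> 0\<close>. Since \<open>w(N - {i}) = w(N) - d\<^sub>i\<close>, the choice \<open>S = N - {i}\<close> gives
  \<open>w(N) d\<^sub>i\<^sup>\<alpha> \<le> d\<^sub>i P(N)\<close>, and summation over \<open>i\<close> yields \<open>w(N) \<le> (\<Sum>i\<in>N. d\<^sub>i)\<close>.
\<close>

text \<open>\<open>powr\<close> is never negative, and a player with a strict gain contributes a
  positive term.\<close>

lemma sum_gain_powr_pos:
  assumes "finite N" "standard N v"
  shows "0 < (\<Sum>j\<in>N. (marginal N v j - individual_worth v j) powr \<alpha>)"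
proof -
  obtain j where "j \<in> N" "individual_worth v j < marginal N v j"
    using assms(2) by (auto simp: standard_def)
  then show ?thesis
    using assms(1) by (intro sum_pos2[of N j]) auto
qed

lemma top_dominant_partitionally_superadditive:
  assumes "finite N" "standard N v" "top_dominant \<alpha> N v"
  shows "partitionally_superadditive N v"
  unfolding partitionally_superadditive_def
proof (intro allI impI)
  fix S assume S: "S \<subseteq> N"
  define p where "p j = (marginal N v j - individual_worth v j) powr \<alpha>" for j
  define w where "w S = v S - sum (individual_worth v) S" for S
  have dom: "w T * sum p N \<le> w N * sum p T" if "T \<subseteq> N" for T
    using assms(3) that unfolding top_dominant_def w_def p_def by blast
  have pos: "0 < sum p N"
    using sum_gain_powr_pos[OF assms(1,2)] unfolding p_def .
  have "(w S + w (N - S)) * sum p N \<le> w N * (sum p S + sum p (N - S))"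
    using dom[OF S] dom[of "N - S"] by (simp add: algebra_simps)
  also have "sum p S + sum p (N - S) = sum p N"
    using sum.subset_diff[OF S assms(1), of p] by simp
  finally have "w S + w (N - S) \<le> w N"
    using pos by (simp add: mult_le_cancel_right)
  \<comment> \<open>The individual worths over \<open>S\<close> and \<open>N - S\<close> add up to
    those over \<open>N\<close> and cancel.\<close>
  then show "v S + v (N - S) \<le> v N"
    using sum.subset_diff[OF S assms(1), of "individual_worth v"] by (simp add: w_def)
qed

lemma top_dominant_essential:
  assumes "finite N" "standard N v" "top_dominant \<alpha> N v"
  shows "essential N v"
proof -
  define d where "d j = marginal N v j - individual_worth v j" for j
  define p where "p j = d j powr \<alpha>" for j
  define w where "w S = v S - sum (individual_worth v) S" for S
  have dom: "w T * sum p N \<le> w N * sum p T" if "T \<subseteq> N" for T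
    using assms(3) that unfolding top_dominant_def w_def p_def d_def by blast
  have pos: "0 < sum p N"
    using sum_gain_powr_pos[OF assms(1,2)] unfolding p_def d_def .
  obtain j where "j \<in> N" "0 < d j"
    using assms(2) by (auto simp: standard_def d_def)
  \<comment> \<open>\<open>w {j} = 0\<close>, so the left side of dominance at \<open>{j}\<close>
    vanishes.\<close>
  then have "0 \<le> w N * p j" "0 < p j"
    using dom[of "{j}"] by (simp_all add: w_def p_def individual_worth_def)
  then have "0 \<le> w N"
    by (simp add: zero_le_mult_iff)
  moreover have "w N \<le> sum d N"
  proof -
    have "w N * p i \<le> d i * sum p N" if "i \<in> N" for i
    proof -
      \<comment> \<open>Removing \<open>i\<close> lowers \<open>v\<close> by its marginal and the
        sum by its individual worth.\<close>
      have "w (N - {i}) = w N - d i" "sum p (N - {i}) = sum p N - p i"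
        using that assms(1) by (simp_all add: w_def d_def marginal_def sum_diff1)
      then have "(w N - d i) * sum p N \<le> w N * (sum p N - p i)"
        using dom[of "N - {i}"] by simp
      then show ?thesis
        by (simp add: algebra_simps)
    qed
    then have "w N * sum p N \<le> sum d N * sum p N"
      unfolding sum_distrib_left[of "w N"] sum_distrib_right[of d] by (rule sum_mono)
    then show ?thesis
      using pos by (simp add: mult_le_cancel_right)
  qed
  \<comment> \<open>In \<open>w N \<le> sum d N\<close> the individual worths cancel, leaving the
    upper bound.\<close>
  ultimately show ?thesis
    by (simp add: essential_def w_def d_def sum_subtractf)
qed

theorem theorem5p5:
  fixes n :: nat and N :: "nat set" and v :: "nat set \<Rightarrow> real"
  assumes "N = {1..n}"
    and "cooperative_game N v"
    and "standard N v"
    and "\<exists>\<alpha>>0. top_dominant \<alpha> N v"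
  shows "regular N v \<and> partitionally_superadditive N v"
proof -
  have "finite N"
    using assms(1) by simp
  moreover obtain \<alpha> where "top_dominant \<alpha> N v"
    using assms(4) by blast
  ultimately show ?thesis
    using assms(3) top_dominant_essential top_dominant_partitionally_superadditive
    by (auto simp: regular_def)
qed

end
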